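(* Consider repeated play of the symmetric $n$-player game ($n\ge2$) described in the context. Let $1 \leq k \leq n-1$ and assume that each of the players $j = 1, \dots, k$ eventually plays a good simple Smale plan (possibly different plans for different players; the choices of players $k+1,\dots,n$ are arbitrary). Let $X = (x_1, \dots, x_k, z_{k+1}, \dots, z_n)$ be a limit point of the sequence of time-averaged payoff vectors $\{s^T\}$, and put $\bar x=\frac1k\sum_{j=1}^k x_j$ and $\bar z=\frac1{n-k}\sum_{j=k+1}^n z_j$. (1) If $\bar z \geq p_n$, then $X = (p_n, \dots, p_n)$. Otherwise, $\bar x < \bar z < p_n$. In particular, if $k = n-1$, then $z_n \geq p_n$ only when $X = (p_n, \dots, p_n)$. (2) Assume in addition that $k \leq n-2$ and put $\tilde z=\frac{1}{n-k-1}\sum_{j=k+2}^n z_j$. If $z_{k+1} \geq p_n$, then either $X = (p_n, \dots, p_n)$ or $\bar x > \tilde z$.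
   Context: The game. Fix an integer $n\ge 2$ and real numbers $r_0,\dots,r_{n-1}$ and $p_1,\dots,p_n$. There are $n$ players; in each round each player chooses to cooperate or to defect. When exactly $k$ players cooperate, each cooperator receives $p_k$ (if $k\ge 1$) and each defector receives $r_k$ (if $k\le n-1$). Put $m_0=r_0$, $m_n=p_n$, and $m_k=\frac1n[k\,p_k+(n-k)\,r_k]$ for $1\le k\le n-1$. Standing assumptions: (i) $r_0<r_1<\dots<r_{n-1}$ and $p_1<p_2<\dots<p_n$; (ii) $p_k<r_{k-1}$ for $k=1,\dots,n$; (iii) $m_0<m_1<\dots<m_n$. Repeated play. The game is played in rounds $T=1,2,\dots$; unless a hypothesis says otherwise, the players' choices are arbitrary. Let $S^T\in\mathbb R^n$ be the vector of payoffs in round $T$ and let $s^T=\frac1T\sum_{t=1}^T S^t$. A limit point of $\{s^T\}$ is a limit of some subsequence. For $x\in\mathbb R^n$ let $\bar\pi(x)=\frac1n\sum_{i=1}^n x_i$ and $\Pi_j(x)=(x_j,\bar\pi(x))\in\mathbb R^2$ for $j=1,\dots,n$. Separation lines. The points $(p_k,m_k)$, $k=1,\dots,n$, are the cooperation points and the points $(r_k,m_k)$, $k=0,\dots,n-1$, are the defection points. A point $(x,y)$ is above (resp. on, below) the line with equation $y=\lambda x+b$ if $y-\lambda x-b$ is $>0$ (resp. $=0$, $<0$). A line $\ell\subset\mathbb R^2$ with equation $y=\lambda x+b$ is a separation line for the game if every cooperation point is on or above $\ell$ and every defection point is on or below $\ell$. Simple Smale plans. Given a separation line $\ell$ with positive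 slope, the simple Smale plan for player $j$ associated with $\ell$ is: in round $T+1$, defect if $\Pi_j(s^T)$ is above $\ell$, and cooperate if $\Pi_j(s^T)$ is on or below $\ell$. It is a good simple Smale plan if $\ell$ passes through $(p_n,p_n)$ and its slope $\lambda$ satisfies $\frac{n-1}{n}<\lambda<1$. A player eventually plays a (good) simple Smale plan if there are a fixed such plan and some $T_0$ such that the player's choice in round $T+1$ follows that plan for all $T\ge T_0$. *)

theory Defs
  imports "HOL-Analysis.Analysis"
begin

text \<open>
  Players are the numbers \<open>1, \<dots>, n\<close>, and a vector of \<open>\<real>\<^sup>n\<close> is a function \<open>nat \<Rightarrow> real\<close> of which only
  the values on \<open>{1..n}\<close> matter.  The payoff parameters \<open>p, r :: nat \<Rightarrow> real\<close> are only used at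
  \<open>p 1, \<dots>, p n\<close> and \<open>r 0, \<dots>, r (n - 1)\<close>.
\<close>

definition mean_payoff :: "nat \<Rightarrow> (nat \<Rightarrow> real) \<Rightarrow> (nat \<Rightarrow> real) \<Rightarrow> nat \<Rightarrow> real" where
  "mean_payoff n p r k =
     (if k = 0 then r 0
      else if k = n then p n
      else (real k * p k + (real n - real k) * r k) / real n)"

locale symmetric_game =
  fixes n :: nat and p r :: "nat \<Rightarrow> real"
  assumes two_players: "2 \<le> n"
    and r_increasing: "strict_mono_on {0..n - 1} r"
    and p_increasing: "strict_mono_on {1..n} p"
    and defection_pays: "\<And>k. k \<in> {1..n} \<Longrightarrow> p k < r (k - 1)"
    and mean_increasing: "strict_mono_on {0..n} (mean_payoff n p r)"

text \<open>
  A play is \<open>c :: nat \<Rightarrow> nat \<Rightarrow> bool\<close>, where \<open>c T j\<close> says that player \<open>j\<close> cooperates in round \<open>T\<close>.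
  Rounds are numbered from 1, so \<open>c 0\<close> is never used.
\<close>

definition num_cooperators :: "nat \<Rightarrow> (nat \<Rightarrow> nat \<Rightarrow> bool) \<Rightarrow> nat \<Rightarrow> nat" where
  "num_cooperators n c T = card {j \<in> {1..n}. c T j}"

definition round_payoff ::
  "nat \<Rightarrow> (nat \<Rightarrow> real) \<Rightarrow> (nat \<Rightarrow> real) \<Rightarrow> (nat \<Rightarrow> nat \<Rightarrow> bool) \<Rightarrow> nat \<Rightarrow> nat \<Rightarrow> real" where
  "round_payoff n p r c T j =
     (if c T j then p (num_cooperators n c T) else r (num_cooperators n c T))"

definition avg_payoff ::
  "nat \<Rightarrow> (nat \<Rightarrow> real) \<Rightarrow> (nat \<Rightarrow> real) \<Rightarrow> (nat \<Rightarrow> nat \<Rightarrow> bool) \<Rightarrow> nat \<Rightarrow> nat \<Rightarrow> real" where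
  "avg_payoff n p r c T j = (1 / real T) * (\<Sum>t = 1..T. round_payoff n p r c t j)"

text \<open>Convergence in \<open>\<real>\<^sup>n\<close> is convergence of each of the \<open>n\<close> coordinates.\<close>

definition limit_point :: "nat \<Rightarrow> (nat \<Rightarrow> nat \<Rightarrow> real) \<Rightarrow> (nat \<Rightarrow> real) \<Rightarrow> bool" where
  "limit_point n s x \<longleftrightarrow>
     (\<exists>\<phi>. strict_mono \<phi> \<and> (\<forall>j\<in>{1..n}. (\<lambda>i. s (\<phi> i) j) \<longlonglongrightarrow> x j))"

definition coord_mean :: "nat \<Rightarrow> (nat \<Rightarrow> real) \<Rightarrow> real" where
  "coord_mean n x = (1 / real n) * (\<Sum>i = 1..n. x i)"

definition proj :: "nat \<Rightarrow> nat \<Rightarrow> (nat \<Rightarrow> real) \<Rightarrow> real \<times> real" where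
  "proj n j x = (x j, coord_mean n x)"

text \<open>
  The non-vertical line \<open>y = lam * x + b\<close> is given by its slope \<open>lam\<close> and its intercept \<open>b\<close>.
\<close>

definition above_line :: "real \<Rightarrow> real \<Rightarrow> real \<times> real \<Rightarrow> bool" where
  "above_line lam b P \<longleftrightarrow> snd P - lam * fst P - b > 0"

definition on_line :: "real \<Rightarrow> real \<Rightarrow> real \<times> real \<Rightarrow> bool" where
  "on_line lam b P \<longleftrightarrow> snd P - lam * fst P - b = 0"

definition below_line :: "real \<Rightarrow> real \<Rightarrow> real \<times> real \<Rightarrow> bool" where
  "below_line lam b P \<longleftrightarrow> snd P - lam * fst P - b < 0"

definition separation_line ::
  "nat \<Rightarrow> (nat \<Rightarrow> real) \<Rightarrow> (nat \<Rightarrow> real) \<Rightarrow> real \<Rightarrow> real \<Rightarrow> bool" where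
  "separation_line n p r lam b \<longleftrightarrow>
     (\<forall>k\<in>{1..n}. on_line lam b (p k, mean_payoff n p r k)
               \<or> above_line lam b (p k, mean_payoff n p r k)) \<and>
     (\<forall>k\<in>{0..n - 1}. on_line lam b (r k, mean_payoff n p r k)
                   \<or> below_line lam b (r k, mean_payoff n p r k))"

text \<open>
  The choice (\<open>True\<close> for cooperation) that the simple Smale plan for player \<open>j\<close> associated with
  the line prescribes after the average payoff vector \<open>x\<close>.
\<close>

definition smale_plan :: "nat \<Rightarrow> real \<Rightarrow> real \<Rightarrow> nat \<Rightarrow> (nat \<Rightarrow> real) \<Rightarrow> bool" where
  "smale_plan n lam b j x \<longleftrightarrow> \<not> above_line lam b (proj n j x)"

definition good_smale_line ::
  "nat \<Rightarrow> (nat \<Rightarrow> real) \<Rightarrow> (nat \<Rightarrow> real) \<Rightarrow> real \<Rightarrow> real \<Rightarrow> bool" where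
  "good_smale_line n p r lam b \<longleftrightarrow>
     separation_line n p r lam b \<and> 0 < lam \<and>
     on_line lam b (p n, p n) \<and> (real n - 1) / real n < lam \<and> lam < 1"

definition eventually_plays_good_smale ::
  "nat \<Rightarrow> (nat \<Rightarrow> real) \<Rightarrow> (nat \<Rightarrow> real) \<Rightarrow> (nat \<Rightarrow> nat \<Rightarrow> bool) \<Rightarrow> nat \<Rightarrow> bool" where
  "eventually_plays_good_smale n p r c j \<longleftrightarrow>
     (\<exists>lam b. good_smale_line n p r lam b \<and>
        (\<exists>T0\<ge>1. \<forall>T\<ge>T0. c (T + 1) j \<longleftrightarrow> smale_plan n lam b j (avg_payoff n p r c T)))"

end

theory Submission
  imports Defs
begin

text \<open>
  For a good simple Smale plan of player \<open>j\<close>, the partial sums of the signed height of the payoffs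
  \<open>\<Pi>\<^sub>j(S\<^sup>t)\<close> over the line never move away from 0 except by overshooting, so they stay bounded and a
  limit point \<open>X\<close> has \<open>\<Pi>\<^sub>j(X)\<close> on the line.  With \<open>D = \<pi>(X) - p\<^sub>n \<le> 0\<close> this says
  \<open>x\<^sub>j - p\<^sub>n = D / \<lambda>\<^sub>j\<close> for \<open>j \<le> k\<close>, where \<open>1 < 1 / \<lambda>\<^sub>j < n / (n - 1)\<close>; the inequalities follow
  by distributing the total \<open>n D\<close> over the players.  If \<open>D = 0\<close>, then the proportion of rounds in
  which everybody cooperates tends to 1, which forces \<open>X = (p\<^sub>n, \<dots>, p\<^sub>n)\<close>.
\<close>

section \<open>Sums whose steps always point back towards 0\<close>

text \<open>A step towards 0 either does not increase the absolute value or crosses 0, and after a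
  crossing the absolute value is at most the step size \<open>M\<close>.\<close>

lemma partial_sums_bounded_of_sign_correction:
  fixes a :: "nat \<Rightarrow> real"
  assumes bound: "\<And>t. \<bar>a t\<bar> \<le> M"
    and down: "\<And>T. T \<ge> T0 \<Longrightarrow> (\<Sum>t = 1..T. a t) > 0 \<Longrightarrow> a (T + 1) \<le> 0"
    and up: "\<And>T. T \<ge> T0 \<Longrightarrow> (\<Sum>t = 1..T. a t) \<le> 0 \<Longrightarrow> a (T + 1) \<ge> 0"
    and "T \<ge> T0"
  shows "\<bar>\<Sum>t = 1..T. a t\<bar> \<le> \<bar>\<Sum>t = 1..T0. a t\<bar> + M"
  using \<open>T \<ge> T0\<close>
proof (induction T rule: dec_induct)
  case base
  \<comment> \<open>The bound at index 0 is used only to get \<open>0 \<le> M\<close>.\<close>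
  show ?case using bound[of 0] by linarith
next
  case (step T)
  have "(\<Sum>t = 1..Suc T. a t) = (\<Sum>t = 1..T. a t) + a (T + 1)" by simp
  then show ?case
    using step.IH bound[of "T + 1"] down[OF step.hyps(1)] up[OF step.hyps(1)]
    by linarith
qed

lemma averages_tendsto_0_of_sign_correction:
  fixes a :: "nat \<Rightarrow> real"
  assumes bound: "\<And>t. \<bar>a t\<bar> \<le> M"
    and down: "\<And>T. T \<ge> T0 \<Longrightarrow> (\<Sum>t = 1..T. a t) > 0 \<Longrightarrow> a (T + 1) \<le> 0"
    and up: "\<And>T. T \<ge> T0 \<Longrightarrow> (\<Sum>t = 1..T. a t) \<le> 0 \<Longrightarrow> a (T + 1) \<ge> 0"
  shows "(\<lambda>T. (1 / real T) * (\<Sum>t = 1..T. a t)) \<longlonglongrightarrow> 0"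
proof (rule Lim_null_comparison)
  let ?B = "\<bar>\<Sum>t = 1..T0. a t\<bar> + M"
  show "\<forall>\<^sub>F T in sequentially. norm ((1 / real T) * (\<Sum>t = 1..T. a t)) \<le> ?B * (1 / real T)"
    using eventually_ge_at_top[of T0]
  proof eventually_elim
    case (elim T)
    have "\<bar>\<Sum>t = 1..T. a t\<bar> / real T \<le> ?B / real T"
      by (intro divide_right_mono partial_sums_bounded_of_sign_correction[of a M T0 T]
            bound down up elim) auto
    then show ?case by (simp add: abs_mult)
  qed
  show "(\<lambda>T. ?B * (1 / real T)) \<longlonglongrightarrow> 0"
    using tendsto_mult[OF tendsto_const[of ?B] lim_1_over_n] by simp
qed

section \<open>Mean payoffs of rounds, of averages and of limits\<close>

lemma num_cooperators_le: "num_cooperators n c t \<le> n"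
proof -
  have "card {j \<in> {1..n}. c t j} \<le> card {1..n}" by (rule card_mono) auto
  then show ?thesis by (simp add: num_cooperators_def)
qed

lemma coord_mean_round_payoff:
  assumes "n > 0"
  shows "coord_mean n (round_payoff n p r c t) = mean_payoff n p r (num_cooperators n c t)"
proof -
  let ?q = "num_cooperators n c t"
  let ?A = "{j \<in> {1..n}. c t j}"
  have q: "card ?A = ?q" by (simp add: num_cooperators_def)
  have "card ({1..n} - ?A) = n - ?q"
    using q by (subst card_Diff_subset) auto
  moreover have "(\<Sum>j = 1..n. round_payoff n p r c t j)
      = (\<Sum>j\<in>{1..n} - ?A. round_payoff n p r c t j) + (\<Sum>j\<in>?A. round_payoff n p r c t j)"
    by (rule sum.subset_diff) auto
  moreover have "(\<Sum>j\<in>{1..n} - ?A. round_payoff n p r c t j) = (\<Sum>j\<in>{1..n} - ?A. r ?q)"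
    by (rule sum.cong) (auto simp: round_payoff_def)
  moreover have "(\<Sum>j\<in>?A. round_payoff n p r c t j) = (\<Sum>j\<in>?A. p ?q)"
    by (rule sum.cong) (auto simp: round_payoff_def)
  ultimately have "(\<Sum>j = 1..n. round_payoff n p r c t j)
      = real ?q * p ?q + (real n - real ?q) * r ?q"
    using q num_cooperators_le[of n c t] by (simp add: of_nat_diff)
  \<comment> \<open>For \<open>?q = 0\<close> and \<open>?q = n\<close> the out-of-range values
    \<open>p 0\<close> and \<open>r n\<close> have coefficient 0, so the formula agrees with the two
    special cases of \<open>mean_payoff\<close>.\<close>
  then show ?thesis
    using assms by (auto simp: coord_mean_def mean_payoff_def)
qed

lemma coord_mean_avg_payoff:
  "coord_mean n (avg_payoff n p r c T)
     = (1 / real T) * (\<Sum>t = 1..T. coord_mean n (round_payoff n p r c t))"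
proof -
  have "(\<Sum>i = 1..n. \<Sum>t = 1..T. round_payoff n p r c t i)
      = (\<Sum>t = 1..T. \<Sum>i = 1..n. round_payoff n p r c t i)"
    by (rule sum.swap)
  then show ?thesis
    by (simp add: coord_mean_def avg_payoff_def flip: sum_distrib_left sum_divide_distrib)
qed

lemma tendsto_coord_mean:
  assumes "\<And>i. i \<in> {1..n} \<Longrightarrow> (\<lambda>m. s m i) \<longlonglongrightarrow> x i"
  shows "(\<lambda>m. coord_mean n (s m)) \<longlonglongrightarrow> coord_mean n x"
  unfolding coord_mean_def by (intro tendsto_intros assms) auto

section \<open>Deviation from full cooperation\<close>

context symmetric_game
begin

lemma mean_payoff_less: "q < n \<Longrightarrow> mean_payoff n p r q < p n"
  using strict_mono_onD[OF mean_increasing, of q n] two_players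
  by (simp add: mean_payoff_def[of n p r n])

lemma mean_payoff_ge: "q \<le> n \<Longrightarrow> mean_payoff n p r 0 \<le> mean_payoff n p r q"
  using mean_increasing by (cases "q = 0") (auto simp: strict_mono_on_def less_imp_le)

text \<open>The mean equals \<open>p n\<close> only under full cooperation, when everybody receives
  exactly \<open>p n\<close>. For each of the finitely many other numbers of cooperators the deficit
  of the mean is positive, so one constant suffices. A bound linear in the deficit survives
  averaging and limits.\<close>

lemma round_payoff_deviation:
  obtains C where "C \<ge> 0"
    "\<And>c t j. j \<in> {1..n} \<Longrightarrow>
       \<bar>round_payoff n p r c t j - p n\<bar> \<le> C * (p n - coord_mean n (round_payoff n p r c t))"
proof
  let ?m = "mean_payoff n p r"
  \<comment> \<open>\<open>g q\<close> bounds the ratio of deviation to deficit with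
    \<open>q\<close> cooperators, whichever choice the player makes; the sum over
    \<open>q < n\<close> stands in for the maximum.\<close>
  define g where "g q = (\<bar>p q - p n\<bar> + \<bar>r q - p n\<bar>) / (p n - ?m q)" for q
  have g_nonneg: "g q \<ge> 0" if "q < n" for q
    using mean_payoff_less[OF that] by (auto simp: g_def)
  show "(\<Sum>q<n. g q) \<ge> 0" by (intro sum_nonneg g_nonneg) auto
  fix c :: "nat \<Rightarrow> nat \<Rightarrow> bool" and t j
  assume j: "j \<in> {1..n}"
  let ?q = "num_cooperators n c t"
  have "\<bar>round_payoff n p r c t j - p n\<bar> \<le> (\<Sum>q<n. g q) * (p n - ?m ?q)"
  proof (cases "?q = n")
    case True
    then have "{j \<in> {1..n}. c t j} = {1..n}"
      by (intro card_subset_eq) (auto simp: num_cooperators_def)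
    then have "c t j" using j by blast
    then show ?thesis
      using True two_players by (simp add: round_payoff_def mean_payoff_def)
  next
    case False
    then have q: "?q < n" using num_cooperators_le[of n c t] by simp
    have "\<bar>round_payoff n p r c t j - p n\<bar> \<le> \<bar>p ?q - p n\<bar> + \<bar>r ?q - p n\<bar>"
      by (simp add: round_payoff_def)
    also have "\<dots> = g ?q * (p n - ?m ?q)"
      using mean_payoff_less[OF q] by (simp add: g_def)
    also have "\<dots> \<le> (\<Sum>q<n. g q) * (p n - ?m ?q)"
      using mean_payoff_less[OF q] q g_nonneg
      by (intro mult_right_mono member_le_sum) auto
    finally show ?thesis .
  qed
  then show "\<bar>round_payoff n p r c t j - p n\<bar>
      \<le> (\<Sum>q<n. g q) * (p n - coord_mean n (round_payoff n p r c t))"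
    using two_players by (simp add: coord_mean_round_payoff)
qed

text \<open>The triangle inequality averages the bounds of the single rounds, since their right-hand
  sides are affine in the mean payoff. The constant does not depend on \<open>T\<close>, so the
  bound passes to limit points.\<close>

lemma avg_payoff_deviation:
  obtains C where
    "\<And>c T j. T > 0 \<Longrightarrow> j \<in> {1..n} \<Longrightarrow>
       \<bar>avg_payoff n p r c T j - p n\<bar> \<le> C * (p n - coord_mean n (avg_payoff n p r c T))"
proof -
  obtain C where C: "\<And>c t j. j \<in> {1..n} \<Longrightarrow>
       \<bar>round_payoff n p r c t j - p n\<bar> \<le> C * (p n - coord_mean n (round_payoff n p r c t))"
    using round_payoff_deviation by metis
  show thesis
  proof (rule that[of C])
    fix c :: "nat \<Rightarrow> nat \<Rightarrow> bool" and T j :: nat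
    assume T: "T > 0" and j: "j \<in> {1..n}"
    let ?S = "round_payoff n p r c"
    have "avg_payoff n p r c T j - p n = (\<Sum>t = 1..T. ?S t j - p n) / real T"
      using T by (simp add: avg_payoff_def sum_subtractf diff_divide_distrib)
    also have "\<bar>\<dots>\<bar> \<le> (\<Sum>t = 1..T. C * (p n - coord_mean n (?S t))) / real T"
      using j by (auto intro!: divide_right_mono order_trans[OF sum_abs] sum_mono C)
    also have "\<dots> = C * (p n - coord_mean n (avg_payoff n p r c T))"
      using T by (simp add: coord_mean_avg_payoff sum_subtractf diff_divide_distrib
          right_diff_distrib flip: sum_distrib_left)
    finally show "\<bar>avg_payoff n p r c T j - p n\<bar>
        \<le> C * (p n - coord_mean n (avg_payoff n p r c T))" .
  qed
qed

lemma coord_mean_round_payoff_le: "coord_mean n (round_payoff n p r c t) \<le> p n"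
  using mean_payoff_less[of "num_cooperators n c t"] num_cooperators_le[of n c t] two_players
  by (cases "num_cooperators n c t = n")
    (auto simp: coord_mean_round_payoff mean_payoff_def[of n p r n])

lemma coord_mean_avg_payoff_le:
  assumes "T > 0"
  shows "coord_mean n (avg_payoff n p r c T) \<le> p n"
proof -
  have "(\<Sum>t = 1..T. coord_mean n (round_payoff n p r c t)) \<le> real T * p n"
    using sum_bounded_above[of "{1..T}" "\<lambda>t. coord_mean n (round_payoff n p r c t)" "p n"]
      coord_mean_round_payoff_le by simp
  then show ?thesis using assms by (simp add: coord_mean_avg_payoff field_simps)
qed

lemma limit_point_mean_le:
  assumes "limit_point n (avg_payoff n p r c) X"
  shows "coord_mean n X \<le> p n"
proof -
  obtain \<phi> where \<phi>: "strict_mono \<phi>"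
      "\<And>j. j \<in> {1..n} \<Longrightarrow> (\<lambda>i. avg_payoff n p r c (\<phi> i) j) \<longlonglongrightarrow> X j"
    using assms by (auto simp: limit_point_def)
  show ?thesis
  proof (rule tendsto_upperbound[OF tendsto_coord_mean[OF \<phi>(2)]])
    show "\<forall>\<^sub>F i in sequentially. coord_mean n (avg_payoff n p r c (\<phi> i)) \<le> p n"
      \<comment> \<open>Since \<open>i \<le> \<phi> i\<close>, restricting to \<open>i > 0\<close>
        avoids round 0, where \<open>avg_payoff\<close> is the default value 0.\<close>
      using eventually_gt_at_top[of 0]
      by eventually_elim
        (metis coord_mean_avg_payoff_le \<phi>(1) less_le_trans seq_suble)
  qed auto
qed

text \<open>In the limit the deviation of each coordinate is at most a constant times the deficit of
  the mean, which is 0 here.\<close>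

lemma limit_point_full_cooperation:
  assumes "limit_point n (avg_payoff n p r c) X" and "coord_mean n X = p n" and "j \<in> {1..n}"
  shows "X j = p n"
proof -
  obtain \<phi> where \<phi>: "strict_mono \<phi>"
      "\<And>j. j \<in> {1..n} \<Longrightarrow> (\<lambda>i. avg_payoff n p r c (\<phi> i) j) \<longlonglongrightarrow> X j"
    using assms(1) by (auto simp: limit_point_def)
  obtain C where C: "\<And>c T j. T > 0 \<Longrightarrow> j \<in> {1..n} \<Longrightarrow>
       \<bar>avg_payoff n p r c T j - p n\<bar> \<le> C * (p n - coord_mean n (avg_payoff n p r c T))"
    using avg_payoff_deviation by metis
  have "\<bar>X j - p n\<bar> \<le> C * (p n - coord_mean n X)"
  proof (rule tendsto_le[OF sequentially_bot])
    show "(\<lambda>i. \<bar>avg_payoff n p r c (\<phi> i) j - p n\<bar>) \<longlonglongrightarrow> \<bar>X j - p n\<bar>"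
      by (intro tendsto_intros \<phi>(2) assms(3))
    show "(\<lambda>i. C * (p n - coord_mean n (avg_payoff n p r c (\<phi> i)))) \<longlonglongrightarrow>
        C * (p n - coord_mean n X)"
      by (intro tendsto_intros tendsto_coord_mean \<phi>(2))
    show "\<forall>\<^sub>F i in sequentially. \<bar>avg_payoff n p r c (\<phi> i) j - p n\<bar>
        \<le> C * (p n - coord_mean n (avg_payoff n p r c (\<phi> i)))"
      using eventually_gt_at_top[of 0]
      by eventually_elim (metis C assms(3) \<phi>(1) less_le_trans seq_suble)
  qed
  then show ?thesis using assms(2) by simp
qed

section \<open>Limit points and the lines of good simple Smale plans\<close>

lemma limit_point_on_good_smale_line:
  assumes X: "limit_point n (avg_payoff n p r c) X"
    and j: "j \<in> {1..n}"
    and smale: "eventually_plays_good_smale n p r c j"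
  obtains lam where "(real n - 1) / real n < lam" "lam < 1"
    "coord_mean n X - p n = lam * (X j - p n)"
proof -
  obtain lam b T0 where line: "good_smale_line n p r lam b" and "T0 \<ge> 1"
    and plan: "\<And>T. T \<ge> T0 \<Longrightarrow> c (T + 1) j \<longleftrightarrow> smale_plan n lam b j (avg_payoff n p r c T)"
    using smale by (auto simp: eventually_plays_good_smale_def)
  have b: "b = p n - lam * p n"
    using line by (simp add: good_smale_line_def on_line_def)
  let ?S = "round_payoff n p r c"
  let ?m = "mean_payoff n p r"
  \<comment> \<open>Signed vertical height of \<open>proj n j x\<close> over the line. It is affine
    in \<open>x\<close>, so the height of the average payoff is the average of the heights
    \<open>a t\<close> of the rounds.\<close>
  define h where "h x = coord_mean n x - lam * x j - b" for x
  define a where "a t = h (?S t)" for t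
  have h_avg: "h (avg_payoff n p r c T) = (1 / real T) * (\<Sum>t = 1..T. a t)" if "T > 0" for T
    using that by (simp add: h_def a_def coord_mean_avg_payoff avg_payoff_def sum_subtractf
        diff_divide_distrib flip: sum_distrib_left)
  have h_S: "h (?S t) = ?m (num_cooperators n c t) - lam * ?S t j - b" for t
    using two_players by (simp add: h_def coord_mean_round_payoff)
  \<comment> \<open>When player \<open>j\<close> cooperates, the round projects to a cooperation
    point, and otherwise to a defection point. The separation property therefore fixes the sign of
    \<open>a t\<close> from the choice of \<open>j\<close> alone, whatever the others do.\<close>
  have a_coop: "a t \<ge> 0" if "c t j" for t
  proof -
    let ?q = "num_cooperators n c t"
    have "{i \<in> {1..n}. c t i} \<noteq> {}" using that j by blast
    then have "?q \<in> {1..n}"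
      using num_cooperators_le[of n c t] unfolding num_cooperators_def
      by (simp add: Suc_le_eq card_gt_0_iff)
    then have "on_line lam b (p ?q, ?m ?q) \<or> above_line lam b (p ?q, ?m ?q)"
      using line unfolding good_smale_line_def separation_line_def by blast
    then show ?thesis
      using that by (auto simp: a_def h_S round_payoff_def on_line_def above_line_def)
  qed
  have a_defect: "a t \<le> 0" if "\<not> c t j" for t
  proof -
    let ?q = "num_cooperators n c t"
    have "{i \<in> {1..n}. c t i} \<subset> {1..n}" using that j by blast
    then have "?q < n"
      unfolding num_cooperators_def by (metis psubset_card_mono card_atLeastAtMost
          finite_atLeastAtMost diff_Suc_1)
    then have "?q \<in> {0..n - 1}" by auto
    then have "on_line lam b (r ?q, ?m ?q) \<or> below_line lam b (r ?q, ?m ?q)"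
      using line unfolding good_smale_line_def separation_line_def by blast
    then show ?thesis
      using that by (auto simp: a_def h_S round_payoff_def on_line_def below_line_def)
  qed
  obtain C where C: "C \<ge> 0" "\<And>c t j. j \<in> {1..n} \<Longrightarrow>
       \<bar>round_payoff n p r c t j - p n\<bar> \<le> C * (p n - coord_mean n (round_payoff n p r c t))"
    using round_payoff_deviation by metis
  \<comment> \<open>As the line passes through \<open>(p n, p n)\<close>, the height is linear in
    the deviations from \<open>p n\<close>. These are controlled by the deficit of the mean, which
    is largest when nobody cooperates.\<close>
  have a_bound: "\<bar>a t\<bar> \<le> (1 + \<bar>lam\<bar> * C) * (p n - ?m 0)" for t
  proof -
    let ?d = "p n - coord_mean n (?S t)"
    have "a t = - ?d - lam * (?S t j - p n)"
      by (simp add: a_def h_def b algebra_simps)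
    also have "\<bar>\<dots>\<bar> \<le> ?d + \<bar>lam\<bar> * \<bar>?S t j - p n\<bar>"
      using coord_mean_round_payoff_le[of c t] by (simp flip: abs_mult)
    also have "\<dots> \<le> ?d + \<bar>lam\<bar> * (C * ?d)"
      using C(2)[OF j, of c t] by (intro add_left_mono mult_left_mono) auto
    also have "\<dots> = (1 + \<bar>lam\<bar> * C) * ?d" by (simp add: algebra_simps)
    also have "\<dots> \<le> (1 + \<bar>lam\<bar> * C) * (p n - ?m 0)"
      using C(1) two_players mean_payoff_ge[OF num_cooperators_le, of c t]
      by (intro mult_left_mono) (auto simp: coord_mean_round_payoff)
    finally show ?thesis .
  qed
  \<comment> \<open>Dividing by \<open>T > 0\<close> keeps the sign, so the plan, which reads the
    average, is a rule about the sign of the partial sum.\<close>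
  have plan_sum: "c (T + 1) j \<longleftrightarrow> (\<Sum>t = 1..T. a t) \<le> 0" if "T \<ge> T0" for T
  proof -
    have T: "T > 0" using that \<open>T0 \<ge> 1\<close> by simp
    have "c (T + 1) j \<longleftrightarrow> \<not> h (avg_payoff n p r c T) > 0"
      using plan[OF that] by (simp add: smale_plan_def above_line_def proj_def h_def)
    then show ?thesis
      using T by (simp add: h_avg[OF T] not_less divide_le_0_iff)
  qed
  have avg_0: "(\<lambda>T. (1 / real T) * (\<Sum>t = 1..T. a t)) \<longlonglongrightarrow> 0"
    by (rule averages_tendsto_0_of_sign_correction[OF a_bound, of T0])
      (use plan_sum a_coop a_defect in \<open>auto simp: not_le\<close>)
  obtain \<phi> where \<phi>: "strict_mono \<phi>"
      "\<And>j. j \<in> {1..n} \<Longrightarrow> (\<lambda>i. avg_payoff n p r c (\<phi> i) j) \<longlonglongrightarrow> X j"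
    using X by (auto simp: limit_point_def)
  have "(\<lambda>i. h (avg_payoff n p r c (\<phi> i))) \<longlonglongrightarrow> h X"
    unfolding h_def by (intro tendsto_intros tendsto_coord_mean \<phi>(2) j)
  moreover have "(\<lambda>i. h (avg_payoff n p r c (\<phi> i))) \<longlonglongrightarrow> 0"
  proof (rule Lim_transform_eventually[OF LIMSEQ_subseq_LIMSEQ[OF avg_0 \<phi>(1)]])
    show "\<forall>\<^sub>F i in sequentially. ((\<lambda>T. (1 / real T) * (\<Sum>t = 1..T. a t)) \<circ> \<phi>) i
        = h (avg_payoff n p r c (\<phi> i))"
      using eventually_gt_at_top[of 0]
      by eventually_elim (metis h_avg \<phi>(1) less_le_trans seq_suble comp_apply)
  qed
  ultimately have "h X = 0" by (rule LIMSEQ_unique)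
  then show thesis
    using line by (intro that[of lam]) (auto simp: good_smale_line_def h_def b algebra_simps)
qed

end

section \<open>Distribution of the total deviation among the players\<close>

theorem theorem4p5:
  fixes n k :: nat and p r :: "nat \<Rightarrow> real"
    and c :: "nat \<Rightarrow> nat \<Rightarrow> bool" and X :: "nat \<Rightarrow> real" and xbar zbar :: real
  assumes "symmetric_game n p r"
    and "1 \<le> k" and "k \<le> n - 1"
    and "\<forall>j\<in>{1..k}. eventually_plays_good_smale n p r c j"
    and "limit_point n (avg_payoff n p r c) X"
    and "xbar = (1 / real k) * (\<Sum>j = 1..k. X j)"
    and "zbar = (1 / (real n - real k)) * (\<Sum>j = k + 1..n. X j)"
  shows "((zbar \<ge> p n \<longrightarrow> (\<forall>j\<in>{1..n}. X j = p n)) \<and>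
          (\<not> zbar \<ge> p n \<longrightarrow> xbar < zbar \<and> zbar < p n) \<and>
          (k = n - 1 \<longrightarrow> X n \<ge> p n \<longrightarrow> (\<forall>j\<in>{1..n}. X j = p n))) \<and>
         (\<forall>ztilde. k \<le> n - 2 \<longrightarrow>
            ztilde = (1 / (real n - real k - 1)) * (\<Sum>j = k + 2..n. X j) \<longrightarrow>
            X (k + 1) \<ge> p n \<longrightarrow>
            (\<forall>j\<in>{1..n}. X j = p n) \<or> xbar > ztilde)"
proof -
  interpret symmetric_game n p r by fact
  have kn: "k < n" using assms(3) two_players by simp
  have "\<forall>j\<in>{1..k}. \<exists>lam. (real n - 1) / real n < lam \<and> lam < 1 \<and>
      coord_mean n X - p n = lam * (X j - p n)"
    using limit_point_on_good_smale_line[OF assms(5)] assms(4) kn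
    by (metis atLeastAtMost_iff less_imp_le order_trans)
  then obtain lam where lam: "\<And>j. j \<in> {1..k} \<Longrightarrow> (real n - 1) / real n < lam j"
      "\<And>j. j \<in> {1..k} \<Longrightarrow> lam j < 1"
      "\<And>j. j \<in> {1..k} \<Longrightarrow> coord_mean n X - p n = lam j * (X j - p n)"
    by metis
  define D where "D = coord_mean n X - p n"
  \<comment> \<open>The first \<open>k\<close> players deviate from \<open>k * p n\<close> by
    \<open>D * \<Lambda>\<close> in total, leaving \<open>D * (n - \<Lambda>)\<close> for the
    others. The slopes then enter only through
    \<open>k < \<Lambda> < k * n / (n - 1)\<close>.\<close>
  define \<Lambda> where "\<Lambda> = (\<Sum>j = 1..k. 1 / lam j)"
  have D_le: "D \<le> 0" using limit_point_mean_le[OF assms(5)] by (simp add: D_def)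
  have all_pn: "\<forall>j\<in>{1..n}. X j = p n" if "D = 0"
    using limit_point_full_cooperation[OF assms(5)] that by (simp add: D_def)
  have lam_pos: "lam j > 0" if "j \<in> {1..k}" for j
    using two_players
    by (intro le_less_trans[OF _ lam(1)[OF that]]) (auto simp: field_simps)
  have "(\<Sum>j = 1..k. 1 / lam j) > (\<Sum>j = 1..k. 1)"
    using assms(2) lam(2) lam_pos by (intro sum_strict_mono) (auto simp: field_simps)
  then have \<Lambda>_gt: "\<Lambda> > real k" by (simp add: \<Lambda>_def)
  have "(\<Sum>j = 1..k. 1 / lam j) < (\<Sum>j = 1..k. real n / (real n - 1))"
    using assms(2) lam(1) lam_pos two_players
    by (intro sum_strict_mono) (auto simp: field_simps)
  then have \<Lambda>_lt: "\<Lambda> * (real n - 1) < real k * real n"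
    using two_players by (simp add: \<Lambda>_def field_simps)
  have "(\<Sum>j = 1..k. X j - p n) = (\<Sum>j = 1..k. D * (1 / lam j))"
  proof (rule sum.cong)
    fix j assume j: "j \<in> {1..k}"
    show "X j - p n = D * (1 / lam j)"
      using lam(3)[OF j] lam_pos[OF j] by (simp add: D_def)
  qed simp
  then have "(\<Sum>j = 1..k. X j - p n) = D * \<Lambda>"
    unfolding \<Lambda>_def by (simp only: sum_distrib_left)
  then have sum_x: "(\<Sum>j = 1..k. X j) = real k * p n + D * \<Lambda>"
    by (simp add: sum_subtractf)
  have "(\<Sum>j = 1..n. X j) = real n * (p n + D)"
    using two_players by (simp add: D_def coord_mean_def)
  moreover have "(\<Sum>j = 1..n. X j) = (\<Sum>j = 1..k. X j) + (\<Sum>j = k + 1..n. X j)"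
    using kn sum.ub_add_nat[of 1 k X "n - k"] by simp
  ultimately have sum_z: "(\<Sum>j = k + 1..n. X j) = (real n - real k) * p n + D * (real n - \<Lambda>)"
    using sum_x by (simp add: algebra_simps)
  have xbar: "xbar - p n = D * (\<Lambda> / real k)"
    using assms(2) unfolding assms(6) sum_x by (simp add: field_simps)
  have zbar: "zbar - p n = D * ((real n - \<Lambda>) / (real n - real k))"
    using kn unfolding assms(7) sum_z by (simp add: field_simps)
  \<comment> \<open>By \<open>k \<le> n - 1\<close>, the upper bound on \<open>\<Lambda>\<close> is
    at most \<open>n\<close>. Hence \<open>zbar - p n\<close> is a positive multiple of
    \<open>D\<close>.\<close>
  have "\<Lambda> * (real n - 1) < (real n - 1) * real n"
    using \<Lambda>_lt kn by (elim less_le_trans) (auto intro!: mult_right_mono)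
  then have \<Lambda>_lt_n: "\<Lambda> < real n" using two_players by (simp add: mult.commute)
  then have z_coeff: "(real n - \<Lambda>) / (real n - real k) > 0" using kn by simp
  have part1: "\<forall>j\<in>{1..n}. X j = p n" if "zbar \<ge> p n"
  proof -
    have "D * ((real n - \<Lambda>) / (real n - real k)) \<ge> 0" using that zbar by simp
    then have "D \<ge> 0" using z_coeff by (metis zero_le_mult_iff not_le)
    then show ?thesis using D_le all_pn by simp
  qed
  have part2: "xbar < zbar" if "zbar < p n"
  proof -
    have D: "D < 0" using that zbar D_le by (cases "D = 0") auto
    \<comment> \<open>Both inequalities say \<open>k < \<Lambda>\<close>, that is, slopes below 1;
      multiplying by \<open>D < 0\<close> reverses the order of the coefficients.\<close>
    have "(real n - \<Lambda>) / (real n - real k) < 1" "1 < \<Lambda> / real k"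
      using \<Lambda>_gt kn assms(2) by (auto simp: field_simps)
    then have "(real n - \<Lambda>) / (real n - real k) < \<Lambda> / real k" by linarith
    then show ?thesis using mult_strict_left_mono_neg[OF _ D] xbar zbar by fastforce
  qed
  have part3: "\<forall>j\<in>{1..n}. X j = p n" if "k = n - 1" "X n \<ge> p n"
  proof (rule part1)
    have "{k + 1..n} = {n}" "real n - real k = 1" using that kn by auto
    then show "zbar \<ge> p n" using that by (simp add: assms(7))
  qed
  have part4: "(\<forall>j\<in>{1..n}. X j = p n) \<or> xbar > ztilde"
    if "k \<le> n - 2" and zt: "ztilde = (1 / (real n - real k - 1)) * (\<Sum>j = k + 2..n. X j)"
      and X1: "X (k + 1) \<ge> p n" for ztilde
  proof (cases "D = 0")
    case True
    then show ?thesis using all_pn by blast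
  next
    case False
    then have D: "D < 0" using D_le by simp
    have pos: "real n - real k - 1 > 0" using that(1) kn assms(2) by linarith
    have "(\<Sum>j = k + 1..n. X j) = X (k + 1) + (\<Sum>j = k + 2..n. X j)"
      using kn sum.atLeast_Suc_atMost[of "k + 1" n X] by simp
    \<comment> \<open>Player \<open>k + 1\<close> bears none of the deficit, so the last
      \<open>n - k - 1\<close> players bear at least all of
      \<open>D * (n - \<Lambda>)\<close>.\<close>
    then have "(\<Sum>j = k + 2..n. X j) \<le> (real n - real k - 1) * p n + D * (real n - \<Lambda>)"
      using sum_z X1 by (simp add: algebra_simps)
    then have "(\<Sum>j = k + 2..n. X j) / (real n - real k - 1)
        \<le> ((real n - real k - 1) * p n + D * (real n - \<Lambda>)) / (real n - real k - 1)"
      using pos by (intro divide_right_mono) auto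
    then have "ztilde - p n \<le> D * ((real n - \<Lambda>) / (real n - real k - 1))"
      using pos by (simp add: zt add_divide_distrib)
    \<comment> \<open>Clearing denominators turns this into
      \<open>\<Lambda> * (n - 1) < k * n\<close>, which is what the lower bound
      \<open>(n - 1) / n\<close> on the slopes provides.\<close>
    also have "\<Lambda> / real k < (real n - \<Lambda>) / (real n - real k - 1)"
      using \<Lambda>_lt pos assms(2) by (simp add: field_simps)
    then have "D * ((real n - \<Lambda>) / (real n - real k - 1)) < D * (\<Lambda> / real k)"
      using D by (rule mult_strict_left_mono_neg)
    finally show ?thesis using xbar by simp
  qed
  show ?thesis using part1 part2 part3 part4 by auto
qed

end
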